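(* Let $g,k\ge 1$ be integers, let $N$ be a positive integer, and consider the PLRS generated by $[\underbrace{1,\ldots,1}_{g},\underbrace{0,\ldots,0}_{k},N]$. (1) If $g\ge k+\lceil \log_2 k\rceil$, then the sequence is complete if and only if $1\le N\le 2^{k+1}-1$. (2) If $k\le g\le k+\lceil\log_2 k\rceil$, then the sequence is complete if and only if $1\le N\le 2^{k+1}-\left\lceil \frac{k}{2^{g-k}}\right\rceil$.
   Context: A positive linear recurrence sequence (PLRS) generated by $[c_1,\ldots,c_L]$, where $L\ge 1$, the $c_i$ are nonnegative integers, $c_1\ge 1$ and $c_L\ge 1$, is the sequence of positive integers $(H_n)_{n\ge1}$ with $H_1=1$, $H_{n+1}=c_1H_n+c_2H_{n-1}+\cdots+c_nH_1+1$ for $1\le n<L$, and $H_{n+1}=c_1H_n+\cdots+c_LH_{n+1-L}$ for $n\ge L$. A sequence of positive integers $(a_i)_{i\ge1}$ is complete if every positive integer $n$ can be written as $n=\sum_{i=1}^\infty \varepsilon_i a_i$ with $\varepsilon_i\in\{0,1\}$; otherwise it is incomplete. *)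

theory Defs
  imports Complex_Main
begin

text \<open>
  The coefficients \<open>c\<^sub>1, \<dots>, c\<^sub>L\<close> are given as the list \<open>c\<close>, so that \<open>c\<^sub>i = c ! (i - 1)\<close>.
  Sequences are indexed from 1; the value at index 0 is a dummy that is never used.
\<close>

function plrs :: "nat list \<Rightarrow> nat \<Rightarrow> nat" where
  "plrs c 0 = 0"
| "plrs c (Suc 0) = 1"
| "plrs c (Suc (Suc m)) =
     (let n = Suc m in
      if n < length c
      then (\<Sum>i = 1..n. c ! (i - 1) * plrs c (n + 1 - i)) + 1
      else (\<Sum>i = 1..length c. c ! (i - 1) * plrs c (n + 1 - i)))"
  by pat_completeness auto
termination
  by (relation "Wellfounded.measure snd") auto

declare plrs.simps(3) [simp del]

definition plrs_coeffs :: "nat list \<Rightarrow> bool" where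
  "plrs_coeffs c \<longleftrightarrow> c \<noteq> [] \<and> hd c \<ge> 1 \<and> last c \<ge> 1"

lemma plrs_rec_less:
  "1 \<le> n \<Longrightarrow> n < length c \<Longrightarrow>
    plrs c (n + 1) = (\<Sum>i = 1..n. c ! (i - 1) * plrs c (n + 1 - i)) + 1"
  by (cases n) (simp_all add: plrs.simps(3))

lemma plrs_rec_ge:
  "1 \<le> n \<Longrightarrow> length c \<le> n \<Longrightarrow>
    plrs c (n + 1) = (\<Sum>i = 1..length c. c ! (i - 1) * plrs c (n + 1 - i))"
  by (cases n) (simp_all add: plrs.simps(3))

lemma plrs_pos:
  assumes c: "plrs_coeffs c" and "n \<ge> 1"
  shows "plrs c n \<ge> 1"
  using assms(2)
proof (induction n rule: dec_induct)
  case (step n)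
  show ?case
  proof (cases "n < length c")
    case True
    then show ?thesis using plrs_rec_less[of n c] step by simp
  next
    case False
    have "1 \<le> c ! (1 - 1) * plrs c (n + 1 - 1)"
      using c step by (cases c) (auto simp: plrs_coeffs_def)
    also have "\<dots> \<le> (\<Sum>i = 1..length c. c ! (i - 1) * plrs c (n + 1 - i))"
      using c by (intro member_le_sum) (auto simp: plrs_coeffs_def Suc_le_eq)
    finally show ?thesis using plrs_rec_ge[of n c] step False by simp
  qed
qed simp

lemma plrs_coeffs_ones_zeros:
  "g \<ge> 1 \<Longrightarrow> N \<ge> 1 \<Longrightarrow> plrs_coeffs (replicate g 1 @ replicate k 0 @ [N])"
  by (cases g) (auto simp: plrs_coeffs_def)

text \<open>
  The series is shifted by one because \<open>sums\<close> starts at index 0 whereas sequences start at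
  index 1. The topology on \<open>nat\<close> is discrete, so convergence means that the partial
  sums are eventually equal to \<open>n\<close>.
\<close>

definition complete_seq :: "(nat \<Rightarrow> nat) \<Rightarrow> bool" where
  "complete_seq a \<longleftrightarrow>
     (\<forall>n\<ge>1. \<exists>\<epsilon>. (\<forall>i. \<epsilon> i \<in> {0, 1}) \<and> (\<lambda>i. \<epsilon> (Suc i) * a (Suc i)) sums n)"

end

theory Submission
  imports Defs
begin

text \<open>
  By Brown's criterion, completeness means \<open>H\<^sub>n\<^sub>+\<^sub>1 \<le> T\<^sub>n\<close> for all \<open>n\<close>, where
  \<open>T\<^sub>n = 1 + H\<^sub>1 + \<dots> + H\<^sub>n\<close>. Substituting the recurrence, this becomes \<open>D\<^sub>m \<ge> 0\<close> for all
  \<open>m \<ge> 1\<close>, where \<open>D\<^sub>m = T\<^sub>m\<^sub>+\<^sub>k - N H\<^sub>m\<close>. For \<open>m \<le> g + 1\<close> and \<open>k \<le> g\<close> there is a closed form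
  of \<open>D\<^sub>m\<close>, and \<open>D\<^sub>g\<^sub>+\<^sub>1 \<ge> 0\<close> holds if and only if \<open>k \<le> (2\<^sup>k\<^sup>+\<^sup>1 - N) 2\<^sup>g\<^sup>-\<^sup>k\<close>, which is the
  bound on \<open>N\<close> in both parts. If it holds then \<open>D\<^sub>m \<ge> 1\<close> for \<open>1 \<le> m \<le> g + 1\<close>. With
  \<open>L = g + k + 1\<close>, for larger \<open>m\<close> we have
  \<open>D\<^sub>m = D\<^sub>m\<^sub>-\<^sub>1 + \<dots> + D\<^sub>m\<^sub>-\<^sub>g + N E + (k + 2 - N)\<close>, where \<open>E = D\<^sub>m\<^sub>-\<^sub>L\<close> if \<open>m > L\<close> and
  \<open>E = T\<^sub>m\<^sub>-\<^sub>g\<^sub>-\<^sub>1 - 1\<close> if \<open>m \<le> L\<close>. Since \<open>E \<ge> 1\<close>, the bound \<open>D\<^sub>m \<ge> 1\<close> propagates to all \<open>m\<close>.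
\<close>

subsection \<open>Brown's criterion\<close>

text \<open>Greedy choice from the top: if \<open>x\<close> exceeds the sum of the first
  \<open>n\<close> terms, then \<open>b n \<le> x\<close>, and the remainder \<open>x - b n\<close>
  is covered by those terms.\<close>

lemma subset_sums_below_total:
  fixes b :: "nat \<Rightarrow> nat"
  assumes "\<And>n. b n \<le> 1 + (\<Sum>i<n. b i)" and "x \<le> (\<Sum>i<n. b i)"
  shows "\<exists>A\<subseteq>{..<n}. (\<Sum>i\<in>A. b i) = x"
  using assms(2)
proof (induction n arbitrary: x)
  case 0
  then show ?case by simp
next
  case (Suc n)
  show ?case
  proof (cases "x \<le> (\<Sum>i<n. b i)")
    case True
    then obtain A where "A \<subseteq> {..<n}" "(\<Sum>i\<in>A. b i) = x" using Suc.IH by blast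
    then show ?thesis by (intro exI[of _ A]) auto
  next
    case False
    then have bx: "b n \<le> x" using assms(1)[of n] by linarith
    have "x - b n \<le> (\<Sum>i<n. b i)" using Suc.prems by simp
    then obtain A where A: "A \<subseteq> {..<n}" "(\<Sum>i\<in>A. b i) = x - b n" using Suc.IH by blast
    have "finite A" "n \<notin> A" using A(1) finite_subset by auto
    then have "(\<Sum>i\<in>insert n A. b i) = x" using A(2) bx by simp
    moreover have "insert n A \<subseteq> {..<Suc n}" using A(1) by auto
    ultimately show ?thesis by blast
  qed
qed

text \<open>If the inequality fails at \<open>n\<close>, then one plus the first \<open>n\<close>
  terms is not representable: these terms fall one short, and by monotonicity every later term is
  too large.\<close>

lemma complete_seq_iff_Brown:
  fixes a :: "nat \<Rightarrow> nat"
  assumes pos: "\<And>n. 1 \<le> a (Suc n)" and mono: "\<And>n. a (Suc n) \<le> a (Suc (Suc n))"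
  shows "complete_seq a \<longleftrightarrow> (\<forall>n. a (Suc n) \<le> 1 + (\<Sum>i<n. a (Suc i)))"
proof
  assume brown: "\<forall>n. a (Suc n) \<le> 1 + (\<Sum>i<n. a (Suc i))"
  show "complete_seq a"
    unfolding complete_seq_def
  proof (intro allI impI)
    fix x :: nat
    \<comment> \<open>All terms are at least 1, so the first \<open>x\<close> of them suffice to
      reach \<open>x\<close>.\<close>
    have "x = (\<Sum>i<x. 1)" by simp
    also have "\<dots> \<le> (\<Sum>i<x. a (Suc i))" by (intro sum_mono) (rule pos)
    finally obtain A where A: "A \<subseteq> {..<x}" "(\<Sum>i\<in>A. a (Suc i)) = x"
      using subset_sums_below_total[of "\<lambda>i. a (Suc i)"] brown by blast
    let ?e = "\<lambda>i. if i - 1 \<in> A then 1 else (0::nat)"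
    have "(\<lambda>i. ?e (Suc i) * a (Suc i)) sums (\<Sum>i\<in>A. ?e (Suc i) * a (Suc i))"
      using A(1) finite_subset by (intro sums_finite) auto
    then have "(\<lambda>i. ?e (Suc i) * a (Suc i)) sums x" using A(2) by simp
    then show "\<exists>\<epsilon>. (\<forall>i. \<epsilon> i \<in> {0, 1}) \<and> (\<lambda>i. \<epsilon> (Suc i) * a (Suc i)) sums x"
      by (intro exI[of _ ?e]) auto
  qed
next
  assume complete: "complete_seq a"
  show "\<forall>n. a (Suc n) \<le> 1 + (\<Sum>i<n. a (Suc i))"
  proof (rule ccontr)
    assume "\<not> ?thesis"
    then obtain n where n: "1 + (\<Sum>i<n. a (Suc i)) < a (Suc n)" by (auto simp: not_le)
    define x where "x = 1 + (\<Sum>i<n. a (Suc i))"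
    obtain e where e: "\<And>i. e i \<in> {0, 1}" and sums: "(\<lambda>i. e (Suc i) * a (Suc i)) sums x"
      using complete unfolding complete_seq_def x_def by (metis le_add1)
    have "eventually (\<lambda>m. (\<Sum>i<m. e (Suc i) * a (Suc i)) = x) sequentially"
      using sums unfolding sums_def tendsto_discrete .
    then obtain m where m: "(\<Sum>i<m. e (Suc i) * a (Suc i)) = x"
      by (auto simp: eventually_sequentially)
    have zero: "e (Suc i) = 0" if "n \<le> i" "i < m" for i
    proof (rule ccontr)
      assume "e (Suc i) \<noteq> 0"
      then have "e (Suc i) * a (Suc i) = a (Suc i)" using e[of "Suc i"] by auto
      then have "a (Suc i) \<le> x"
        using m member_le_sum[of i "{..<m}" "\<lambda>i. e (Suc i) * a (Suc i)"] that by auto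
      moreover have "a (Suc n) \<le> a (Suc i)"
        using lift_Suc_mono_le[of "\<lambda>i. a (Suc i)", OF mono \<open>n \<le> i\<close>] .
      ultimately show False using n x_def by linarith
    qed
    have "x = (\<Sum>i\<in>{..<m} \<inter> {..<n}. e (Suc i) * a (Suc i))"
      unfolding m[symmetric] by (intro sum.mono_neutral_right) (use zero in \<open>force simp: not_less\<close>)+
    also have "\<dots> \<le> (\<Sum>i\<in>{..<m} \<inter> {..<n}. a (Suc i))"
    proof (rule sum_mono)
      fix i
      show "e (Suc i) * a (Suc i) \<le> a (Suc i)" using e[of "Suc i"] by auto
    qed
    also have "\<dots> \<le> (\<Sum>i<n. a (Suc i))" by (intro sum_mono2) auto
    finally show False using x_def by simp
  qed
qed

subsection \<open>The sequence generated by ones, zeros and a final coefficient\<close>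

locale ones_zeros_plrs =
  fixes g k N :: nat
  assumes g_pos: "1 \<le> g" and k_pos: "1 \<le> k" and N_pos: "1 \<le> N"
begin

definition coeffs :: "nat list" where
  "coeffs = replicate g 1 @ replicate k 0 @ [N]"

text \<open>Cast to integers because the differences \<open>D\<close> may be negative.\<close>

definition H :: "nat \<Rightarrow> int" where
  "H n = int (plrs coeffs n)"

definition T :: "nat \<Rightarrow> int" where
  "T n = 1 + (\<Sum>i = 1..n. H i)"

definition D :: "nat \<Rightarrow> int" where
  "D m = T (m + k) - int N * H m"

lemma coeffs_nth:
  "coeffs ! i = (if i < g then 1 else if i < g + k then 0 else N)" if "i < g + k + 1"
  using that by (auto simp: coeffs_def nth_append)

lemma length_coeffs: "length coeffs = g + k + 1"
  by (simp add: coeffs_def)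

lemma H_pos: "1 \<le> H (Suc n)"
  using plrs_pos[OF plrs_coeffs_ones_zeros[OF g_pos N_pos, of k], of "Suc n"]
  by (simp add: H_def coeffs_def)

lemma T_0: "T 0 = 1"
  by (simp add: T_def)

lemma T_Suc: "T (Suc n) = T n + H (Suc n)"
  by (simp add: T_def)

lemma T_ge_Suc: "int n + 1 \<le> T n"
proof (induction n)
  case (Suc n)
  then show ?case using T_Suc[of n] H_pos[of n] by simp
qed (simp add: T_0)

lemma sum_ones_coeffs:
  assumes "m \<le> g" "m \<le> n"
  shows "(\<Sum>i = 1..m. int (coeffs ! (i - 1)) * H (n + 1 - i)) = (\<Sum>i = Suc n - m..<Suc n. H i)"
proof -
  have "(\<Sum>i = 1..m. int (coeffs ! (i - 1)) * H (n + 1 - i)) = (\<Sum>i = 1..m. H (n + 1 - i))"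
  proof (rule sum.cong)
    fix i assume "i \<in> {1..m}"
    then have "i - 1 < g" using assms by auto
    then show "int (coeffs ! (i - 1)) * H (n + 1 - i) = H (n + 1 - i)"
      by (simp add: coeffs_nth)
  qed simp
  also have "\<dots> = (\<Sum>i = Suc n - m..<Suc n. H i)"
    using assms
    by (intro sum.reindex_bij_witness[of _ "\<lambda>i. n + 1 - i" "\<lambda>i. n + 1 - i"]) auto
  finally show ?thesis .
qed

lemma H_initial:
  assumes "n \<le> g"
  shows "H (Suc n) = T n"
proof (cases "n = 0")
  case True
  then show ?thesis by (simp add: H_def T_0)
next
  case False
  have "H (Suc n) = (\<Sum>i = 1..n. int (coeffs ! (i - 1)) * H (n + 1 - i)) + 1"
    using plrs_rec_less[of n coeffs] assms False by (simp add: H_def length_coeffs)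
  also have "\<dots> = T n"
    unfolding T_def using sum_ones_coeffs[of n n] assms
    by (simp add: atLeastLessThanSuc_atLeastAtMost)
  finally show ?thesis .
qed

text \<open>The index is at most the length \<open>g + k + 1\<close>, so the extra 1 is still added,
  while the zeros hide all but the \<open>g\<close> latest terms.\<close>

lemma H_middle:
  assumes "j \<le> k"
  shows "H (g + 1 + j) = (\<Sum>i = Suc j..<Suc j + g. H i) + 1"
proof -
  let ?f = "\<lambda>i. int (coeffs ! (i - 1)) * H (g + j + 1 - i)"
  have "H (g + 1 + j) = (\<Sum>i = 1..g + j. ?f i) + 1"
    using plrs_rec_less[of "g + j" coeffs] assms g_pos by (simp add: H_def length_coeffs)
  also have "(\<Sum>i = 1..g + j. ?f i) = (\<Sum>i = 1..g. ?f i)"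
    using assms by (intro sum.mono_neutral_right) (auto simp: coeffs_nth)
  also have "\<dots> = (\<Sum>i = Suc j..<Suc j + g. H i)"
    using sum_ones_coeffs[of g "g + j"] by (simp add: add.commute)
  finally show ?thesis .
qed

lemma H_tail:
  "H (g + k + 2 + j) = (\<Sum>i = k + 2 + j..<k + 2 + j + g. H i) + int N * H (Suc j)"
proof -
  let ?n = "g + k + 1 + j"
  let ?f = "\<lambda>i. int (coeffs ! (i - 1)) * H (?n + 1 - i)"
  have "H (g + k + 2 + j) = (\<Sum>i = 1..g + k + 1. ?f i)"
    using plrs_rec_ge[of ?n coeffs] by (simp add: H_def length_coeffs)
  also have "\<dots> = (\<Sum>i = 1..g + k. ?f i) + int N * H (Suc j)"
    by (simp add: coeffs_nth)
  also have "(\<Sum>i = 1..g + k. ?f i) = (\<Sum>i = 1..g. ?f i)"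
    by (intro sum.mono_neutral_right) (auto simp: coeffs_nth)
  also have "\<dots> = (\<Sum>i = k + 2 + j..<k + 2 + j + g. H i)"
    using sum_ones_coeffs[of g ?n] by (simp add: add_ac)
  finally show ?thesis .
qed

lemma sum_H_interval: "(\<Sum>i = Suc m..<Suc m + l. H i) = T (m + l) - T m"
  by (induction l) (auto simp: T_Suc)

lemma H_middle': "j \<le> k \<Longrightarrow> H (Suc (g + j)) = T (g + j) - T j + 1"
  using H_middle[of j] sum_H_interval[of j g] by (simp add: add_ac)

text \<open>From this index on, the slack in Brown's inequality is exactly a value of
  \<open>D\<close>.\<close>

lemma H_tail':
  "H (Suc (g + k + Suc j)) = T (g + k + Suc j) - D (Suc j)"
  using H_tail[of j] sum_H_interval[of "k + 1 + j" g] by (simp add: D_def add_ac)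

lemma H_mono: "H (Suc n) \<le> H (Suc (Suc n))"
proof (cases "Suc n \<le> g")
  case True
  then show ?thesis
    using H_initial[of "Suc n"] T_Suc[of n] T_ge_Suc[of n] by simp
next
  case False
  then obtain j where n: "Suc n = g + j" by (metis nat_le_linear le_Suc_ex)
  \<comment> \<open>The window of \<open>g\<close> ones ends at \<open>Suc n\<close>, so
    \<open>H (Suc n)\<close> is itself a summand of the next term.\<close>
  have last: "H (Suc n) \<le> (\<Sum>i = Suc j..<Suc j + g. H i)"
  proof (rule member_le_sum)
    show "Suc n \<in> {Suc j..<Suc j + g}" using n g_pos by auto
    show "0 \<le> H i" if "i \<in> {Suc j..<Suc j + g} - {Suc n}" for i
      using that H_pos[of "i - 1"] by auto
  qed simp
  show ?thesis
  proof (cases "j \<le> k")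
    case True
    then show ?thesis using last H_middle[OF True] n by simp
  next
    case False
    then obtain l where l: "j = k + 1 + l" by (metis Suc_eq_plus1 less_eqE not_less_eq_eq)
    have "0 \<le> int N * H (Suc l)" using H_pos[of l] by simp
    moreover have "Suc (Suc n) = g + k + 2 + l" using n l by simp
    ultimately show ?thesis using last H_tail[of l] l by simp
  qed
qed

subsection \<open>Closed forms and the sign of \<open>D\<close>\<close>

lemma T_initial: "n \<le> Suc g \<Longrightarrow> T n = 2 ^ n"
  by (induction n) (auto simp: T_0 T_Suc H_initial)

text \<open>Since \<open>k \<le> g\<close>, the term \<open>T j\<close> subtracted in
  \<open>H_middle'\<close> is still \<open>2 ^ j\<close>, which leaves an explicit doubling
  recurrence for \<open>T\<close>.\<close>

lemma T_middle:
  assumes "k \<le> g"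
  shows "q \<le> k \<Longrightarrow> T (g + 1 + q) = 2 ^ (g + 1 + q) - (int q - 1) * 2 ^ q - 1"
proof (induction q)
  case 0
  then show ?case using T_initial[of "g + 1"] by simp
next
  case (Suc q)
  have "T (g + 1 + Suc q) = 2 * T (g + Suc q) - T (Suc q) + 1"
    using H_middle'[of "Suc q"] Suc.prems T_Suc[of "g + Suc q"] by simp
  also have "T (Suc q) = 2 ^ Suc q" using Suc.prems assms by (intro T_initial) simp
  finally show ?case using Suc by (simp add: algebra_simps)
qed

text \<open>At this index \<open>H\<close> is still a power of 2, while \<open>T\<close> is taken at
  \<open>g + 1 + q\<close>, where \<open>T_middle\<close> applies. The case \<open>q = k\<close> is
  \<open>D (Suc g)\<close>.\<close>

lemma D_closed:
  assumes "k \<le> g" "q \<le> k"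
  shows "D (g - k + q + 1) =
    2 ^ q * ((2 ^ (k + 1) - int N) * 2 ^ (g - k) - (int q - 1)) - 1"
proof -
  obtain d where d: "g = k + d" using assms(1) le_Suc_ex by blast
  have "H (Suc (d + q)) = 2 ^ (d + q)"
    using H_initial[of "d + q"] T_initial[of "d + q"] assms d by simp
  moreover have "T (Suc (d + q) + k) = 2 ^ (d + k + 1 + q) - (int q - 1) * 2 ^ q - 1"
  proof -
    have "Suc (d + q) + k = g + 1 + q" using d by simp
    then show ?thesis using T_middle[OF assms] d by (simp only: add_ac)
  qed
  ultimately have "D (Suc (d + q)) =
      2 ^ (d + k + 1 + q) - (int q - 1) * 2 ^ q - 1 - int N * 2 ^ (d + q)"
    by (simp only: D_def)
  then show ?thesis using d by (simp add: power_add algebra_simps)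
qed

lemma D_early:
  assumes "p + k \<le> g"
  shows "D (Suc p) = (2 ^ (k + 1) - int N) * 2 ^ p"
proof -
  have "H (Suc p) = 2 ^ p" "T (Suc p + k) = 2 ^ (Suc p + k)"
    using H_initial[of p] T_initial[of p] T_initial[of "Suc p + k"] assms by simp_all
  then show ?thesis by (simp add: D_def power_add algebra_simps)
qed

text \<open>As \<open>D (Suc g) + 1\<close> is \<open>2 ^ k\<close> times an integer, nonnegativity
  means that this integer is positive.\<close>

lemma D_Suc_g_nonneg_iff:
  assumes "k \<le> g"
  shows "0 \<le> D (Suc g) \<longleftrightarrow> int k \<le> (2 ^ (k + 1) - int N) * 2 ^ (g - k)"
proof -
  let ?x = "(2 ^ (k + 1) - int N) * 2 ^ (g - k) - (int k - 1)"
  have "D (Suc g) = 2 ^ k * ?x - 1" using D_closed[OF assms, of k] assms by simp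
  then have "0 \<le> D (Suc g) \<longleftrightarrow> 0 < 2 ^ k * ?x" by linarith
  also have "\<dots> \<longleftrightarrow> 0 < ?x" by (simp add: zero_less_mult_iff)
  finally show ?thesis by linarith
qed

lemma D_initial_pos:
  assumes "k \<le> g" and bound: "int k \<le> (2 ^ (k + 1) - int N) * 2 ^ (g - k)"
    and "p \<le> g"
  shows "1 \<le> D (Suc p)"
proof -
  let ?r = "2 ^ (k + 1) - int N"
  have "0 < ?r * 2 ^ (g - k)" using bound k_pos by linarith
  then have r: "0 < ?r" by (simp add: zero_less_mult_iff)
  show ?thesis
  proof (cases "p + k \<le> g")
    case True
    have "0 < ?r * 2 ^ p" using r by simp
    then show ?thesis using D_early[OF True] by linarith
  next
    case False
    define q where "q = p + k - g"
    have q: "1 \<le> q" "q \<le> k" "g - k + q + 1 = Suc p" using False assms by (auto simp: q_def)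
    \<comment> \<open>The bracket in \<open>D_closed\<close> is at least 1 and its factor
      \<open>2 ^ q\<close> at least 2; this gives \<open>D \<ge> 1\<close> rather than only
      \<open>D \<ge> 0\<close>.\<close>
    have "(2::int) ^ 1 \<le> 2 ^ q" using q(1) by (intro power_increasing) auto
    then have "2 \<le> (2::int) ^ q * 1" by simp
    also have "\<dots> \<le> 2 ^ q * (?r * 2 ^ (g - k) - (int q - 1))"
      using bound q(2) by (intro mult_left_mono) auto
    also have "\<dots> = D (Suc p) + 1" using D_closed[OF assms(1) q(2)] q(3) by simp
    finally show ?thesis by simp
  qed
qed

subsection \<open>Propagation\<close>

text \<open>Summed form of \<open>H_middle\<close>, whose extra 1 accumulates to
  \<open>int j\<close>. The 2 comes from the base case, where the powers of 2 in the window sum to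
  \<open>2 ^ (g + 1) - 2\<close>.\<close>

lemma T_middle_rec:
  "j \<le> k \<Longrightarrow> T (g + 1 + j) = (\<Sum>i = Suc j..<Suc j + g. T i) + int j + 2"
proof (induction j)
  case 0
  have "(\<Sum>i = Suc 0..<Suc 0 + m. T i) = 2 ^ Suc m - 2" if "m \<le> g" for m
    using that by (induction m) (auto simp: T_initial)
  from this[of g] show ?case using T_initial[of "g + 1"] by simp
next
  case (Suc j)
  have "(\<Sum>i = Suc (Suc j)..<Suc (Suc j) + g. T i) =
      (\<Sum>i = Suc j..<Suc j + g. T (Suc i))"
    by (simp only: add_Suc sum.shift_bounds_Suc_ivl)
  also have "\<dots> = (\<Sum>i = Suc j..<Suc j + g. T i) + (\<Sum>i = Suc j..<Suc j + g. H (Suc i))"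
    by (simp only: T_Suc sum.distrib)
  also have "(\<Sum>i = Suc j..<Suc j + g. H (Suc i)) = (\<Sum>i = Suc (Suc j)..<Suc (Suc j) + g. H i)"
    by (simp only: add_Suc sum.shift_bounds_Suc_ivl)
  also have "\<dots> = H (g + 1 + Suc j) - 1" using H_middle[of "Suc j"] Suc.prems by simp
  finally show ?case using Suc T_Suc[of "g + 1 + j"] by simp
qed

text \<open>Continues \<open>T_middle_rec\<close> from \<open>j = k\<close>, where
  \<open>N * T 0 - N\<close> vanishes. The constant no longer changes, because \<open>H_tail\<close>
  adds no 1.\<close>

lemma T_tail_rec:
  "T (g + k + 1 + j) =
     (\<Sum>i = k + 1 + j..<k + 1 + j + g. T i) + int N * T j + (int k + 2 - int N)"
proof (induction j)
  case 0
  then show ?case using T_middle_rec[of k] by (simp add: T_0 add_ac)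
next
  case (Suc j)
  have "(\<Sum>i = k + 1 + Suc j..<k + 1 + Suc j + g. T i) =
      (\<Sum>i = k + 1 + j..<k + 1 + j + g. T (Suc i))"
    by (simp only: add_Suc add_Suc_right sum.shift_bounds_Suc_ivl)
  also have "\<dots> = (\<Sum>i = k + 1 + j..<k + 1 + j + g. T i) + (\<Sum>i = k + 1 + j..<k + 1 + j + g. H (Suc i))"
    by (simp only: T_Suc sum.distrib)
  also have "(\<Sum>i = k + 1 + j..<k + 1 + j + g. H (Suc i)) = (\<Sum>i = k + 2 + j..<k + 2 + j + g. H i)"
    using sum.shift_bounds_Suc_ivl[of H "k + 1 + j" "k + 1 + j + g"] by simp
  also have "\<dots> = H (g + k + 2 + j) - int N * H (Suc j)" using H_tail[of j] by simp
  finally show ?case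
    using Suc T_Suc[of "g + k + 1 + j"] T_Suc[of j] by (simp add: algebra_simps)
qed

text \<open>Subtracts \<open>N\<close> times the recurrence of \<open>H\<close> from the shifted
  recurrence of \<open>T\<close>. For \<open>j > k\<close>, the terms in \<open>T j\<close> and
  \<open>H (j - k)\<close> combine to \<open>N * D (j - k)\<close>.\<close>

lemma D_rec:
  "D (g + 1 + j) = (\<Sum>i = Suc j..<Suc j + g. D i) + int N * T j + (int k + 2 - int N)
     - int N * (if j \<le> k then 1 else int N * H (j - k))"
proof -
  have "(\<Sum>i = k + 1 + j..<k + 1 + j + g. T i) = (\<Sum>i = Suc j..<Suc j + g. T (i + k))"
    using sum.shift_bounds_nat_ivl[of T "Suc j" k "Suc j + g"] by (simp add: add_ac)
  then have T: "T (g + 1 + j + k) =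
      (\<Sum>i = Suc j..<Suc j + g. T (i + k)) + int N * T j + (int k + 2 - int N)"
    using T_tail_rec[of j] by (simp add: add_ac)
  have H: "H (g + 1 + j) =
      (\<Sum>i = Suc j..<Suc j + g. H i) + (if j \<le> k then 1 else int N * H (j - k))"
  proof (cases "j \<le> k")
    case True
    then show ?thesis using H_middle by simp
  next
    case False
    then obtain l where "j = k + 1 + l" by (metis Suc_eq_plus1 less_eqE not_less_eq_eq)
    then show ?thesis using H_tail[of l] by (simp add: add_ac)
  qed
  show ?thesis
    unfolding D_def T H by (simp add: sum_subtractf sum_distrib_left algebra_simps)
qed

lemma D_pos:
  assumes init: "\<And>p. p \<le> g \<Longrightarrow> 1 \<le> D (Suc p)"
  shows "1 \<le> D (Suc m)"
proof (induction m rule: less_induct)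
  case (less m)
  show ?case
  proof (cases "m \<le> g")
    case True
    then show ?thesis by (rule init)
  next
    case False
    define j where "j = m - g"
    have m: "Suc m = g + 1 + j" and j: "1 \<le> j" using False by (auto simp: j_def)
    have "0 \<le> (\<Sum>i = Suc j..<Suc j + g. D i)"
    proof (rule sum_nonneg)
      fix i assume "i \<in> {Suc j..<Suc j + g}"
      then show "0 \<le> D i" using less[of "i - 1"] m by fastforce
    qed
    \<comment> \<open>The lower bound must be 1, not 0: multiplied by \<open>N\<close> it cancels
      the \<open>- N\<close> in the constant of \<open>D_rec\<close>. Hence the induction carries
      \<open>1 \<le> D\<close> and not just \<open>0 \<le> D\<close>.\<close>
    moreover have "1 \<le> T j - (if j \<le> k then 1 else int N * H (j - k))"
    proof (cases "j \<le> k")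
      case True
      then show ?thesis using T_ge_Suc[of j] j by simp
    next
      case False
      then have "1 \<le> D (j - k)" using less[of "j - k - 1"] m by (simp add: Suc_diff_Suc)
      then show ?thesis using False by (simp add: D_def)
    qed
    then have "int N * 1 \<le> int N * (T j - (if j \<le> k then 1 else int N * H (j - k)))"
      by (intro mult_left_mono) auto
    ultimately show ?thesis using D_rec[of j] m by (simp add: right_diff_distrib)
  qed
qed

section \<open>Completeness as a single inequality\<close>

lemma complete_iff:
  assumes "k \<le> g"
  shows "complete_seq (plrs coeffs) \<longleftrightarrow> int k \<le> (2 ^ (k + 1) - int N) * 2 ^ (g - k)"
proof -
  have "complete_seq (plrs coeffs) \<longleftrightarrow>
      (\<forall>n. plrs coeffs (Suc n) \<le> 1 + (\<Sum>i<n. plrs coeffs (Suc i)))"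
    using H_pos H_mono by (intro complete_seq_iff_Brown) (auto simp: H_def)
  also have "\<dots> \<longleftrightarrow> (\<forall>n. H (Suc n) \<le> T n)"
  proof -
    have "T n = int (1 + (\<Sum>i<n. plrs coeffs (Suc i)))" for n
      by (simp add: T_def H_def sum.atLeast1_atMost_eq)
    then show ?thesis by (simp only: H_def of_nat_le_iff)
  qed
  also have "\<dots> \<longleftrightarrow> (\<forall>m. 0 \<le> D (Suc m))"
  proof
    assume "\<forall>n. H (Suc n) \<le> T n"
    then have "H (Suc (g + k + Suc m)) \<le> T (g + k + Suc m)" for m by blast
    then show "\<forall>m. 0 \<le> D (Suc m)" using H_tail' by simp
  next
    assume D: "\<forall>m. 0 \<le> D (Suc m)"
    show "\<forall>n. H (Suc n) \<le> T n"
    proof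
      fix n
      \<comment> \<open>In the first two ranges the slack is 0 and \<open>T j - 1\<close>, so
        Brown's inequality is automatic there.\<close>
      consider "n \<le> g" | j where "n = g + j" "j \<le> k" | j where "n = g + k + Suc j"
        by (metis add.assoc le_Suc_ex nat_le_linear not_less_eq_eq add_Suc_shift)
      then show "H (Suc n) \<le> T n"
      proof cases
        case 1
        then show ?thesis using H_initial by simp
      next
        case (2 j)
        then show ?thesis using H_middle'[of j] T_ge_Suc[of j] by simp
      next
        case (3 j)
        then show ?thesis using H_tail'[of j] D by simp
      qed
    qed
  qed
  \<comment> \<open>The value at \<open>Suc g\<close> decides: if it is nonnegative, the bound
    holds, so \<open>D\<close> is positive up to \<open>g + 1\<close> and then everywhere.\<close>
  also have "\<dots> \<longleftrightarrow> 0 \<le> D (Suc g)"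
    using D_pos D_initial_pos[OF assms] D_Suc_g_nonneg_iff[OF assms]
    by (meson order_trans zero_le_one)
  finally show ?thesis using D_Suc_g_nonneg_iff[OF assms] by simp
qed

end

section \<open>Ceiling and logarithm forms of the bound\<close>

theorem theorem1p16:
  fixes g k N :: nat
  assumes "g \<ge> 1" and "k \<ge> 1" and "N \<ge> 1"
  shows "(int g \<ge> int k + \<lceil>log 2 (real k)\<rceil> \<longrightarrow>
            (complete_seq (plrs (replicate g 1 @ replicate k 0 @ [N])) \<longleftrightarrow>
               1 \<le> N \<and> N \<le> 2 ^ (k + 1) - 1)) \<and>
         (k \<le> g \<and> int g \<le> int k + \<lceil>log 2 (real k)\<rceil> \<longrightarrow>
            (complete_seq (plrs (replicate g 1 @ replicate k 0 @ [N])) \<longleftrightarrow>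
               1 \<le> N \<and> int N \<le> 2 ^ (k + 1) - \<lceil>real k / 2 ^ (g - k)\<rceil>))"
proof -
  interpret ones_zeros_plrs g k N by unfold_locales fact+
  let ?complete = "complete_seq (plrs (replicate g 1 @ replicate k 0 @ [N]))"
  have complete: "?complete \<longleftrightarrow> int N \<le> 2 ^ (k + 1) - \<lceil>real k / 2 ^ (g - k)\<rceil>" if "k \<le> g"
  proof -
    let ?r = "2 ^ (k + 1) - int N"
    have "?complete \<longleftrightarrow> int k \<le> ?r * 2 ^ (g - k)"
      using complete_iff[OF that] by (simp add: coeffs_def)
    also have "\<dots> \<longleftrightarrow> real_of_int (int k) \<le> real_of_int (?r * 2 ^ (g - k))"
      by (simp only: of_int_le_iff)
    also have "\<dots> \<longleftrightarrow> real k / 2 ^ (g - k) \<le> real_of_int ?r"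
      by (simp add: pos_divide_le_eq)
    also have "\<dots> \<longleftrightarrow> \<lceil>real k / 2 ^ (g - k)\<rceil> \<le> ?r"
      by (simp only: ceiling_le_iff)
    finally show ?thesis by linarith
  qed
  have "?complete \<longleftrightarrow> N \<le> 2 ^ (k + 1) - 1" if g: "int g \<ge> int k + \<lceil>log 2 (real k)\<rceil>"
  proof -
    have "0 \<le> log 2 (real k)" using assms(2) by simp
    then have "0 \<le> \<lceil>log 2 (real k)\<rceil>" by linarith
    then have kg: "k \<le> g" using g by linarith
    have "log 2 (real k) \<le> real (g - k)" using g kg by linarith
    then have "real k \<le> 2 powr real (g - k)" using assms(2) by (simp add: log_le_iff)
    \<comment> \<open>From \<open>0 < k \<le> 2 ^ (g - k)\<close> the quotient lies in the interval
      (0, 1].\<close>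
    then have "\<lceil>real k / 2 ^ (g - k)\<rceil> = 1"
      using assms(2) by (intro ceiling_unique) (simp_all add: powr_realpow)
    then have "?complete \<longleftrightarrow> int N \<le> int (2 ^ (k + 1)) - 1" using complete[OF kg] by simp
    also have "\<dots> \<longleftrightarrow> int N \<le> int (2 ^ (k + 1) - 1)" by (simp add: of_nat_diff)
    also have "\<dots> \<longleftrightarrow> N \<le> 2 ^ (k + 1) - 1" by (rule of_nat_le_iff)
    finally show ?thesis .
  qed
  then show ?thesis using complete assms(3) by simp
qed

end
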